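(* Let $R$ be an associative ring with identity, let $n\ge 3$, and let $g\in GL(n,R)$ be a matrix at least one of whose entries belongs to the Jacobson radical $J(R)$ of $R$. Then $g$ is a stable element.
   Context: "Ideal" means two-sided ideal; $a^b=bab^{-1}$, $[a,b]=aba^{-1}b^{-1}$. $e_{ij}$ are the standard matrix units, $t_{ij}(r)=1+re_{ij}$ ($i\ne j$, $r\in R$) are called transvections, and $E(n,R)$ is the subgroup of $GL(n,R)$ generated by all transvections. For an ideal $I$ of $R$: $E_I$ is the subgroup generated by all $t_{ij}(x)$, $x\in I$, $i\neq j$; $E(n,I)$ is the normal closure of $E_I$ in $E(n,R)$; $C_I=\ker(GL(n,R)\to GL(n,R/I))$. Stable element: $g\in GL(n,R)$ is stable if: for all ideals $I,J$ of $R$ with $g\in C_I$ one has $[g,E(n,J)]\subseteq E(n,I)\cap E(n,J)$; and for every subgroup $N$ of $GL(n,R)$ that is normalized by $E(n,R)$ and contains no non-identity transvections, $g\in N$ implies that $g$ lies in the center of $GL(n,R)$. *)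

theory Defs
  imports "HOL-Analysis.Finite_Cartesian_Product" "HOL-Algebra.Generated_Groups"
begin

text \<open>
  The sort \<open>{ring, monoid_mult}\<close> consists of the associative, not necessarily commutative rings
  with identity. Unlike \<open>ring_1\<close> it does not require \<open>0 \<noteq> 1\<close>, so the zero ring is included. The
  library's matrix product and identity matrix need that axiom, hence the matrix monoid below.
\<close>

definition mat_monoid :: "('a::{ring,monoid_mult}^'n^'n) monoid" where
  "mat_monoid = \<lparr>carrier = UNIV,
                 mult = (\<lambda>A B. \<chi> i j. \<Sum>k\<in>UNIV. A $ i $ k * B $ k $ j),
                 one = (\<chi> i j. if i = j then 1 else 0)\<rparr>"

definition GL :: "('a::{ring,monoid_mult}^'n^'n) monoid" where
  "GL = units_of mat_monoid"

definition left_ideal :: "'a::{ring,monoid_mult} set \<Rightarrow> bool" where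
  "left_ideal L \<longleftrightarrow>
     0 \<in> L \<and> (\<forall>x\<in>L. \<forall>y\<in>L. x - y \<in> L) \<and> (\<forall>x\<in>L. \<forall>r. r * x \<in> L)"

definition two_sided_ideal :: "'a::{ring,monoid_mult} set \<Rightarrow> bool" where
  "two_sided_ideal I \<longleftrightarrow> left_ideal I \<and> (\<forall>x\<in>I. \<forall>r. x * r \<in> I)"

definition maximal_left_ideal :: "'a::{ring,monoid_mult} set \<Rightarrow> bool" where
  "maximal_left_ideal M \<longleftrightarrow>
     left_ideal M \<and> M \<noteq> UNIV \<and> (\<forall>L. left_ideal L \<and> M \<subseteq> L \<longrightarrow> L = M \<or> L = UNIV)"

definition jacobson_radical :: "'a::{ring,monoid_mult} set" where
  "jacobson_radical = \<Inter>{M. maximal_left_ideal M}"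

text \<open>Meaningful for \<open>i \<noteq> j\<close> only.\<close>

definition transvection :: "'n \<Rightarrow> 'n \<Rightarrow> 'a \<Rightarrow> 'a::{ring,monoid_mult}^'n^'n" where
  "transvection i j r =
     (\<chi> k l. (if k = l then 1 else 0) + (if k = i \<and> l = j then r else 0))"

text \<open>
  \<open>elem_sub I\<close> is the subgroup \<open>E\<^sub>I\<close> generated by the transvections with entry in \<open>I\<close>, and
  \<open>rel_elem_group I\<close> is \<open>E(n, I)\<close>, the normal closure of \<open>E\<^sub>I\<close> in \<open>E(n, R)\<close>.
\<close>

definition elem_sub :: "'a::{ring,monoid_mult} set \<Rightarrow> ('a^'n^'n) set" where
  "elem_sub I = generate GL {transvection i j x | i j x. i \<noteq> j \<and> x \<in> I}"

definition elem_group :: "('a::{ring,monoid_mult}^'n^'n) set" where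
  "elem_group = generate GL {transvection i j r | i j r. i \<noteq> j}"

definition rel_elem_group :: "'a::{ring,monoid_mult} set \<Rightarrow> ('a^'n^'n) set" where
  "rel_elem_group I =
     generate GL {e \<otimes>\<^bsub>GL\<^esub> x \<otimes>\<^bsub>GL\<^esub> inv\<^bsub>GL\<^esub> e | e x. e \<in> elem_group \<and> x \<in> elem_sub I}"

text \<open>
  The kernel of \<open>GL(n, R) \<rightarrow> GL(n, R/I)\<close>: entrywise, the classes of \<open>g\<close> and of the identity matrix
  in \<open>R/I\<close>, that is, the additive cosets of \<open>I\<close>, agree.
\<close>

definition congruence_subgroup :: "'a::{ring,monoid_mult} set \<Rightarrow> ('a^'n^'n) set" where
  "congruence_subgroup I =
     {g \<in> carrier GL. \<forall>i j. (\<lambda>a. g $ i $ j + a) ` I = (\<lambda>a. \<one>\<^bsub>GL\<^esub> $ i $ j + a) ` I}"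

definition commutator_subgroup :: "'a::{ring,monoid_mult}^'n^'n \<Rightarrow> ('a^'n^'n) set \<Rightarrow> ('a^'n^'n) set"
  where "commutator_subgroup g H =
     generate GL {g \<otimes>\<^bsub>GL\<^esub> h \<otimes>\<^bsub>GL\<^esub> inv\<^bsub>GL\<^esub> g \<otimes>\<^bsub>GL\<^esub> inv\<^bsub>GL\<^esub> h | h. h \<in> H}"

definition normalized_by_elem_group :: "('a::{ring,monoid_mult}^'n^'n) set \<Rightarrow> bool" where
  "normalized_by_elem_group N \<longleftrightarrow>
     (\<forall>e\<in>elem_group. (\<lambda>x. e \<otimes>\<^bsub>GL\<^esub> x \<otimes>\<^bsub>GL\<^esub> inv\<^bsub>GL\<^esub> e) ` N = N)"

definition center_GL :: "('a::{ring,monoid_mult}^'n^'n) set" where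
  "center_GL = {z \<in> carrier GL. \<forall>h\<in>carrier GL. z \<otimes>\<^bsub>GL\<^esub> h = h \<otimes>\<^bsub>GL\<^esub> z}"

definition stable_element :: "'a::{ring,monoid_mult}^'n^'n \<Rightarrow> bool" where
  "stable_element g \<longleftrightarrow> g \<in> carrier GL \<and>
     (\<forall>I J. two_sided_ideal I \<and> two_sided_ideal J \<and> g \<in> congruence_subgroup I \<longrightarrow>
        commutator_subgroup g (rel_elem_group J) \<subseteq> rel_elem_group I \<inter> rel_elem_group J) \<and>
     (\<forall>N. subgroup N GL \<and> normalized_by_elem_group N \<and>
        (\<forall>i j r. i \<noteq> j \<and> transvection i j r \<in> N \<longrightarrow> transvection i j r = \<one>\<^bsub>GL\<^esub>) \<and>
        g \<in> N \<longrightarrow> g \<in> center_GL)"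

end

theory Submission
  imports Defs
begin

text \<open>
  If \<open>g\<^sub>i\<^sub>j\<close> lies in the Jacobson radical, then the \<open>j\<close>-th column of \<open>g\<close> without its \<open>i\<close>-th entry is
  left unimodular, and the \<open>i\<close>-th row without its \<open>j\<close>-th entry is right unimodular.

  The column statement lets elementary row operations put any value in place of \<open>g\<^sub>i\<^sub>j\<close>. If \<open>g\<close> is
  congruent to \<open>1\<close> modulo \<open>I\<close>, one obtains \<open>g = \<epsilon> h \<delta>\<close> with \<open>\<epsilon>, \<delta> \<in> E(n, I)\<close> and \<open>h\<close> having the \<open>j\<close>-th
  row and column of the identity matrix. For such an \<open>h\<close> the commutators with \<open>t\<^sub>j\<^sub>k(r)\<close> and \<open>t\<^sub>k\<^sub>j(r)\<close>
  are visibly products of transvections, and the remaining \<open>t\<^sub>k\<^sub>l(r)\<close> are commutators of these.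

  The row statement provides a column \<open>c\<close> with \<open>c\<^sub>j = 0\<close> such that the \<open>i\<close>-th entry of
  \<open>g (e\<^sub>j + c)\<close> vanishes. For \<open>k \<noteq> i, j\<close> the transvection \<open>t = t\<^sub>k\<^sub>i(1)\<close> then fixes this vector, so that
  \<open>t\<^sup>-\<^sup>1 g\<^sup>-\<^sup>1 t g\<close>, conjugated by \<open>1 + c e\<^sub>j\<^sup>T\<close>, maps \<open>e\<^sub>j\<close> to some \<open>e\<^sub>j + e\<^sub>k b\<close>. In a subgroup
  normalized by \<open>E(n, R)\<close> without transvections, such an element is trivial, so \<open>g\<close> commutes with \<open>t\<close>
  and hence is a central scalar.
\<close>

section \<open>Unimodularity from the Jacobson radical\<close>

text \<open>If \<open>1 - a * x\<close> had no left inverse, the left ideal it generates would be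
  proper and, by Zorn's lemma, lie in a maximal left ideal \<open>M\<close>. Since \<open>x\<close>,
  and so \<open>a * x\<close>, belongs to \<open>M\<close>, this forces \<open>1\<close> into
  \<open>M\<close>.\<close>

lemma left_inverse_jacobson:
  fixes x :: "'a::{ring,monoid_mult}"
  assumes x: "x \<in> jacobson_radical"
  shows "\<exists>t. t * (1 - a * x) = 1"
proof (rule ccontr)
  assume no: "\<nexists>t. t * (1 - a * x) = 1"
  define L0 where "L0 = range (\<lambda>t. t * (1 - a * x))"
  \<comment> \<open>For left ideals, omitting \<open>1\<close> is the same as being proper, and this
    form passes to unions of chains.\<close>
  define \<L> where "\<L> = {L. left_ideal L \<and> L0 \<subseteq> L \<and> 1 \<notin> L}"
  have "left_ideal L0"
    unfolding left_ideal_def L0_def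
  proof (intro conjI ballI allI)
    show "0 \<in> range (\<lambda>t. t * (1 - a * x))"
      by (rule image_eqI[of _ _ 0]) auto
    fix y z r
    assume y: "y \<in> range (\<lambda>t. t * (1 - a * x))"
    then obtain s where s: "y = s * (1 - a * x)" by auto
    show "r * y \<in> range (\<lambda>t. t * (1 - a * x))"
      by (rule image_eqI[of _ _ "r * s"]) (auto simp: s mult.assoc)
    assume "z \<in> range (\<lambda>t. t * (1 - a * x))"
    then obtain t where t: "z = t * (1 - a * x)" by auto
    show "y - z \<in> range (\<lambda>t. t * (1 - a * x))"
      by (rule image_eqI[of _ _ "s - t"]) (auto simp: s t left_diff_distrib)
  qed
  moreover have "1 \<notin> L0"
    using no by (auto simp: L0_def)
  ultimately have "L0 \<in> \<L>" by (simp add: \<L>_def)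
  moreover have "\<Union>\<C> \<in> \<L>" if ne: "\<C> \<noteq> {}" and ch: "subset.chain \<L> \<C>" for \<C>
  proof -
    have lid: "left_ideal L" "L0 \<subseteq> L" "1 \<notin> L" if "L \<in> \<C>" for L
      using ch that by (auto simp: \<L>_def subset.chain_def)
    have "y - z \<in> \<Union>\<C>" if yz: "y \<in> \<Union>\<C>" "z \<in> \<Union>\<C>" for y z
    proof -
      obtain Y Z where "y \<in> Y" "Y \<in> \<C>" "z \<in> Z" "Z \<in> \<C>" using yz by auto
      then obtain W where "W \<in> \<C>" "y \<in> W" "z \<in> W"
        using ch unfolding subset.chain_def by blast
      then show ?thesis using lid(1)[of W] by (auto simp: left_ideal_def)
    qed
    then have "left_ideal (\<Union>\<C>)"
      using lid(1) ne unfolding left_ideal_def by blast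
    then show ?thesis using lid(2,3) ne by (auto simp: \<L>_def)
  qed
  ultimately obtain M where M: "M \<in> \<L>" and max: "\<And>X. X \<in> \<L> \<Longrightarrow> M \<subseteq> X \<Longrightarrow> X = M"
    using subset_Zorn_nonempty[of \<L>] by blast
  have M': "left_ideal M" "L0 \<subseteq> M" "1 \<notin> M"
    using M by (auto simp: \<L>_def)
  have "maximal_left_ideal M"
    unfolding maximal_left_ideal_def
  proof (intro conjI allI impI)
    fix L assume L: "left_ideal L \<and> M \<subseteq> L"
    show "L = M \<or> L = UNIV"
    proof (cases "1 \<in> L")
      case True
      have "r * 1 \<in> L" for r using L True unfolding left_ideal_def by blast
      then show ?thesis by auto
    next
      case False
      then show ?thesis using max[of L] L M' by (auto simp: \<L>_def)
    qed
  qed (use M' in auto)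
  then have "x \<in> M" using x by (auto simp: jacobson_radical_def)
  then have 1: "a * x \<in> M" using M' by (auto simp: left_ideal_def)
  have "1 * (1 - a * x) \<in> L0" unfolding L0_def by blast
  then have "1 - a * x \<in> M" using M'(2) by auto
  then have "(1 - a * x) - (0 - a * x) \<in> M"
    using 1 M'(1) unfolding left_ideal_def by blast
  then show False using M'(3) by simp
qed

text \<open>The radical is defined by left ideals, so the right-hand version has to be derived. A
  left inverse \<open>t\<close> of \<open>1 - a * x\<close> equals \<open>1 + t * a * x\<close>,
  hence has a left inverse itself and is a two-sided inverse. Then \<open>1 + x * t * a\<close> is a
  right inverse of \<open>1 - x * a\<close>.\<close>

lemma right_inverse_jacobson:
  fixes x :: "'a::{ring,monoid_mult}"
  assumes x: "x \<in> jacobson_radical"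
  shows "\<exists>t. (1 - x * a) * t = 1"
proof -
  obtain t where t: "t * (1 - a * x) = 1" using left_inverse_jacobson[OF x] by blast
  obtain s where s: "s * (1 - (- (t * a)) * x) = 1" using left_inverse_jacobson[OF x] by blast
  have "t = 1 + t * a * x" using t by (simp add: algebra_simps)
  then have "s * t = 1" using s by simp
  then have "s = s * (t * (1 - a * x))" using t by simp
  also have "\<dots> = 1 - a * x" using \<open>s * t = 1\<close> by (simp flip: mult.assoc)
  finally have "(1 - a * x) * t = 1" using \<open>s * t = 1\<close> by simp
  then have "t = 1 + a * x * t" by (simp add: algebra_simps)
  then have "x * (t * a) = x * ((1 + a * x * t) * a)" by simp
  then have "x * (t * a) = x * a + x * a * x * t * a"
    by (simp only: distrib_left distrib_right mult.assoc mult_1_left)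
  then have "(1 - x * a) * (1 + x * t * a) = 1"
    by (simp add: algebra_simps)
  then show ?thesis by blast
qed

text \<open>Dropping position \<open>j\<close> from the relation leaves
  \<open>1 - v j * a j\<close>, which is right invertible; the remaining coefficients are rescaled
  by its right inverse.\<close>

lemma row_unimodular_jacobson:
  fixes v :: "'n::finite \<Rightarrow> 'a::{ring,monoid_mult}"
  assumes "v j \<in> jacobson_radical" and va: "(\<Sum>l\<in>UNIV. v l * a l) = 1"
  shows "\<exists>w. w j = 0 \<and> (\<Sum>l\<in>UNIV. v l * w l) = 1"
proof -
  obtain t where t: "(1 - v j * a j) * t = 1" using right_inverse_jacobson[OF assms(1)] by blast
  have eq: "(\<Sum>l\<in>UNIV - {j}. v l * a l) = 1 - v j * a j"
    using va by (simp add: sum.remove[of UNIV j] algebra_simps)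
  have "(\<Sum>l\<in>UNIV. v l * (if l = j then 0 else a l * t)) = (\<Sum>l\<in>UNIV - {j}. v l * a l) * t"
    by (simp add: sum.remove[of UNIV j] sum_distrib_right mult.assoc)
  then show ?thesis using t eq by (intro exI[of _ "\<lambda>l. if l = j then 0 else a l * t"]) simp
qed

lemma column_unimodular_jacobson:
  fixes u :: "'n::finite \<Rightarrow> 'a::{ring,monoid_mult}"
  assumes "u i \<in> jacobson_radical" and au: "(\<Sum>l\<in>UNIV. a l * u l) = 1"
  shows "\<exists>w. w i = 0 \<and> (\<Sum>l\<in>UNIV. w l * u l) = 1"
proof -
  obtain t where t: "t * (1 - a i * u i) = 1" using left_inverse_jacobson[OF assms(1)] by blast
  have eq: "(\<Sum>l\<in>UNIV - {i}. a l * u l) = 1 - a i * u i"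
    using au by (simp add: sum.remove[of UNIV i] algebra_simps)
  have "(\<Sum>l\<in>UNIV. (if l = i then 0 else t * a l) * u l) = t * (\<Sum>l\<in>UNIV - {i}. a l * u l)"
    by (simp add: sum.remove[of UNIV i] sum_distrib_left mult.assoc)
  then show ?thesis using t eq by (intro exI[of _ "\<lambda>l. if l = i then 0 else t * a l"]) simp
qed

section \<open>Matrices and elementary groups\<close>

abbreviation mmul :: "'a::{ring,monoid_mult}^'n^'n \<Rightarrow> 'a^'n^'n \<Rightarrow> 'a^'n^'n" (infixl \<open>\<star>\<close> 70)
  where "A \<star> B \<equiv> A \<otimes>\<^bsub>GL\<^esub> B"

abbreviation minv :: "'a::{ring,monoid_mult}^'n^'n \<Rightarrow> 'a^'n^'n"
  where "minv A \<equiv> inv\<^bsub>GL\<^esub> A"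

lemma GL_mult_nth: "(A \<star> B) $ i $ j = (\<Sum>k\<in>UNIV. A $ i $ k * B $ k $ j)"
  by (simp add: GL_def units_of_def mat_monoid_def)

lemma GL_one_nth: "\<one>\<^bsub>GL\<^esub> $ i $ j = (if i = j then 1 else 0)"
  by (simp add: GL_def units_of_def mat_monoid_def)

text \<open>Pulls factors into Kronecker deltas, so that the simplifier can collapse the sums in
  matrix products.\<close>

lemma delta_mult:
  fixes x y :: "'a::{ring,monoid_mult}"
  shows "(if P then x else 0) * y = (if P then x * y else 0)"
    "y * (if P then x else 0) = (if P then y * x else 0)"
  by simp_all

text \<open>\<open>GL\<close> inherits the product of \<open>mat_monoid\<close>, which is total on
  matrices; the unit and associativity laws therefore rewrite unconditionally.\<close>

lemma GL_mult_one_right [simp]: "A \<star> \<one>\<^bsub>GL\<^esub> = A"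
  by (simp add: vec_eq_iff GL_mult_nth GL_one_nth delta_mult)

lemma GL_mult_one_left [simp]: "\<one>\<^bsub>GL\<^esub> \<star> A = A"
  by (simp add: vec_eq_iff GL_mult_nth GL_one_nth delta_mult)

lemma GL_mult_assoc: "A \<star> B \<star> C = A \<star> (B \<star> C)"
proof -
  have "(\<Sum>k\<in>UNIV. (\<Sum>l\<in>UNIV. A $ i $ l * B $ l $ k) * C $ k $ j)
      = (\<Sum>l\<in>UNIV. A $ i $ l * (\<Sum>k\<in>UNIV. B $ l $ k * C $ k $ j))" for i j
    unfolding sum_distrib_left sum_distrib_right mult.assoc by (rule sum.swap)
  then show ?thesis by (simp add: vec_eq_iff GL_mult_nth)
qed

lemma monoid_mat_monoid: "monoid (mat_monoid :: ('a::{ring,monoid_mult}^'n^'n) monoid)"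
proof -
  have "mult (mat_monoid :: ('a^'n^'n) monoid) = mult GL" "one (mat_monoid :: ('a^'n^'n) monoid) = one GL"
    by (simp_all add: GL_def units_of_def)
  then show ?thesis
    by (intro monoidI) (simp_all add: GL_mult_assoc, simp_all add: mat_monoid_def)
qed

interpretation GL: group "GL :: ('a::{ring,monoid_mult}^'n^'n) monoid"
  unfolding GL_def by (rule monoid.units_group[OF monoid_mat_monoid])

lemma GL_carrierI:
  assumes "A \<star> B = \<one>\<^bsub>GL\<^esub>" "B \<star> A = \<one>\<^bsub>GL\<^esub>"
  shows "A \<in> carrier GL"
proof -
  have "A \<in> Units mat_monoid"
    unfolding Units_def using assms
    by (auto simp: GL_def units_of_def) (auto simp: mat_monoid_def)
  then show ?thesis by (simp add: GL_def units_of_def)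
qed

lemma transvection_mult_nth:
  "(transvection i j r \<star> A) $ k $ l = A $ k $ l + (if k = i then r * A $ j $ l else 0)"
  by (simp add: GL_mult_nth transvection_def distrib_right sum.distrib delta_mult
cong: if_cong)

lemma mult_transvection_nth:
  "(A \<star> transvection i j r) $ k $ l = A $ k $ l + (if l = j then A $ k $ i * r else 0)"
  by (simp add: GL_mult_nth transvection_def distrib_left sum.distrib delta_mult
cong: if_cong)

lemma GL_inv_cancel [simp]:
  assumes "A \<in> carrier GL"
  shows "minv A \<star> (A \<star> B) = B" "A \<star> (minv A \<star> B) = B"
  using assms by (simp_all flip: GL_mult_assoc)

text \<open>Being a subgroup, this preimage under conjugation contains a generated group as soon as
  it contains the generators.\<close>

lemma GL_conj_subgroup:
  assumes "subgroup K GL" and h: "h \<in> carrier GL"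
  shows "subgroup {x \<in> carrier GL. h \<star> x \<star> minv h \<in> K} GL"
proof (rule GL.subgroupI)
  have "h \<star> \<one>\<^bsub>GL\<^esub> \<star> minv h \<in> K"
    using assms by (simp add: subgroup.one_closed)
  then show "{x \<in> carrier GL. h \<star> x \<star> minv h \<in> K} \<noteq> {}" by blast
  fix x assume x: "x \<in> {x \<in> carrier GL. h \<star> x \<star> minv h \<in> K}"
  then have "minv (h \<star> x \<star> minv h) \<in> K" using assms by (simp add: subgroup.m_inv_closed)
  then show "minv x \<in> {x \<in> carrier GL. h \<star> x \<star> minv h \<in> K}"
    using x h by (simp add: GL.inv_mult_group GL_mult_assoc)
  fix y assume y: "y \<in> {x \<in> carrier GL. h \<star> x \<star> minv h \<in> K}"
  have "(h \<star> x \<star> minv h) \<star> (h \<star> y \<star> minv h) \<in> K"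
    using x y assms by (simp add: subgroup.m_closed)
  then show "x \<star> y \<in> {x \<in> carrier GL. h \<star> x \<star> minv h \<in> K}"
    using x y h by (simp add: GL_mult_assoc)
qed auto

text \<open>Follows from \<open>[h, xy] = [h, x] x [h, y] x^-1\<close> and
  \<open>[h, x^-1] = x^-1 [h, x]^-1 x\<close>, as \<open>E\<close> normalizes
  \<open>K\<close>.\<close>

lemma GL_commutator_subgroup:
  assumes E: "subgroup E GL" and K: "subgroup K GL" and h: "h \<in> carrier GL"
    and norm: "\<And>e x. e \<in> E \<Longrightarrow> x \<in> K \<Longrightarrow> e \<star> x \<star> minv e \<in> K"
  shows "subgroup {x \<in> E. h \<star> x \<star> minv h \<star> minv x \<in> K} GL"
proof (rule GL.subgroupI)
  note car = subgroup.mem_carrier[OF E]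
  show "{x \<in> E. h \<star> x \<star> minv h \<star> minv x \<in> K} \<subseteq> carrier GL" using car by auto
  have "h \<star> \<one>\<^bsub>GL\<^esub> \<star> minv h \<star> minv \<one>\<^bsub>GL\<^esub> \<in> K"
    using K h by (simp add: subgroup.one_closed)
  then show "{x \<in> E. h \<star> x \<star> minv h \<star> minv x \<in> K} \<noteq> {}"
    using subgroup.one_closed[OF E] by blast
  fix x assume x: "x \<in> {x \<in> E. h \<star> x \<star> minv h \<star> minv x \<in> K}"
  then have xE: "x \<in> E" "x \<in> carrier GL" "minv x \<in> E" using car E by (auto simp: subgroup.m_inv_closed)
  have "minv (h \<star> x \<star> minv h \<star> minv x) \<in> K" using x K by (simp add: subgroup.m_inv_closed)
  then have "minv x \<star> minv (h \<star> x \<star> minv h \<star> minv x) \<star> minv (minv x) \<in> K"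
    using norm xE by blast
  then show "minv x \<in> {x \<in> E. h \<star> x \<star> minv h \<star> minv x \<in> K}"
    using xE h by (simp add: GL.inv_mult_group GL_mult_assoc)
  fix y assume y: "y \<in> {x \<in> E. h \<star> x \<star> minv h \<star> minv x \<in> K}"
  then have yE: "y \<in> E" "y \<in> carrier GL" using car by auto
  have "x \<star> (h \<star> y \<star> minv h \<star> minv y) \<star> minv x \<in> K" using norm xE y by blast
  then have "(h \<star> x \<star> minv h \<star> minv x) \<star> (x \<star> (h \<star> y \<star> minv h \<star> minv y) \<star> minv x) \<in> K"
    using x K by (simp add: subgroup.m_closed)
  then show "x \<star> y \<in> {x \<in> E. h \<star> x \<star> minv h \<star> minv x \<in> K}"
    using xE yE h E by (simp add: GL.inv_mult_group GL_mult_assoc subgroup.m_closed)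
qed

text \<open>Reduces the evaluation of a commutator to comparing entries of two products free of
  inverses.\<close>

lemma GL_eq_commutator:
  assumes "g \<in> carrier GL" "h \<in> carrier GL" "g \<star> h = c \<star> h \<star> g"
  shows "g \<star> h \<star> minv g \<star> minv h = c"
  using assms by (simp add: GL_mult_assoc)

definition row_unipotent :: "'n \<Rightarrow> ('n \<Rightarrow> 'a) \<Rightarrow> 'a::{ring,monoid_mult}^'n^'n" where
  "row_unipotent j z = (\<chi> k l. (if k = l then 1 else 0) + (if k = j then z l else 0))"

definition col_unipotent :: "'n \<Rightarrow> ('n \<Rightarrow> 'a) \<Rightarrow> 'a::{ring,monoid_mult}^'n^'n" where
  "col_unipotent j c = (\<chi> k l. (if k = l then 1 else 0) + (if l = j then c k else 0))"

lemma row_unipotent_mult_nth: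
  "(row_unipotent j z \<star> A) $ k $ l = A $ k $ l + (if k = j then \<Sum>m\<in>UNIV. z m * A $ m $ l else 0)"
  by (simp add: GL_mult_nth row_unipotent_def distrib_right sum.distrib delta_mult)

lemma mult_row_unipotent_nth:
  "(A \<star> row_unipotent j z) $ k $ l = A $ k $ l + A $ k $ j * z l"
  by (simp add: GL_mult_nth row_unipotent_def distrib_left sum.distrib delta_mult)

lemma col_unipotent_mult_nth:
  "(col_unipotent j c \<star> A) $ k $ l = A $ k $ l + c k * A $ j $ l"
  by (simp add: GL_mult_nth col_unipotent_def distrib_right sum.distrib delta_mult)

lemma transvection_nth:
  "transvection i j r $ k $ l = (if k = l then 1 else 0) + (if k = i \<and> l = j then r else 0)"
  by (simp add: transvection_def)

lemma transvection_add:
  assumes "i \<noteq> j"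
  shows "transvection i j r \<star> transvection i j s = transvection i j (r + s)"
  using assms by (auto simp: vec_eq_iff transvection_mult_nth transvection_nth)

lemma transvection_zero: "transvection i j 0 = \<one>\<^bsub>GL\<^esub>"
  by (simp add: vec_eq_iff transvection_nth GL_one_nth)

lemma transvection_eq_one_iff: "transvection i j r = \<one>\<^bsub>GL\<^esub> \<longleftrightarrow> r = 0"
  by (auto simp: vec_eq_iff transvection_nth GL_one_nth)

lemma transvection_carrier [simp]: "i \<noteq> j \<Longrightarrow> transvection i j r \<in> carrier GL"
  by (rule GL_carrierI[of _ "transvection i j (- r)"]) (simp_all add: transvection_add transvection_zero)

lemma minv_transvection: "i \<noteq> j \<Longrightarrow> minv (transvection i j r) = transvection i j (- r)"
  by (rule GL.inv_equality) (simp_all add: transvection_add transvection_zero)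

section \<open>Elementary and relative elementary groups\<close>

lemma subgroup_elem_sub: "subgroup (elem_sub I) GL"
  unfolding elem_sub_def by (rule GL.generate_is_subgroup) auto

lemma transvection_elem_sub: "i \<noteq> j \<Longrightarrow> r \<in> I \<Longrightarrow> transvection i j r \<in> elem_sub I"
  unfolding elem_sub_def by (rule generate.incl) blast

lemma elem_group_eq: "elem_group = elem_sub UNIV"
  by (simp add: elem_group_def elem_sub_def)

lemma subgroup_elem_group: "subgroup elem_group GL"
  by (simp add: elem_group_eq subgroup_elem_sub)

lemma elem_sub_subset_elem_group: "elem_sub I \<subseteq> elem_group"
  unfolding elem_sub_def elem_group_def by (rule GL.mono_generate) auto

lemmas elem_group_carrier = subgroup.mem_carrier[OF subgroup_elem_group]
lemmas elem_group_mult = subgroup.m_closed[OF subgroup_elem_group]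
lemmas elem_group_inv = subgroup.m_inv_closed[OF subgroup_elem_group]

lemma transvection_elem_group: "i \<noteq> j \<Longrightarrow> transvection i j r \<in> elem_group"
  by (simp add: elem_group_eq transvection_elem_sub)

lemma subgroup_rel_elem_group: "subgroup (rel_elem_group I) GL"
  unfolding rel_elem_group_def
  by (rule GL.generate_is_subgroup)
    (auto intro!: elem_group_carrier elem_group_mult elem_group_inv
      dest: subsetD[OF elem_sub_subset_elem_group])

lemma elem_sub_subset_rel: "elem_sub I \<subseteq> rel_elem_group I"
proof
  fix x :: "'a^'b^'b" assume x: "x \<in> elem_sub I"
  have "\<one>\<^bsub>GL\<^esub> \<star> x \<star> minv \<one>\<^bsub>GL\<^esub> \<in> rel_elem_group I"
    unfolding rel_elem_group_def using subgroup.one_closed[OF subgroup_elem_group] x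
    by (intro generate.incl) blast
  then show "x \<in> rel_elem_group I" by simp
qed

lemma rel_elem_group_subset: "rel_elem_group I \<subseteq> elem_group"
  unfolding rel_elem_group_def using elem_sub_subset_elem_group
  by (intro GL.generate_subgroup_incl subgroup_elem_group)
    (auto intro!: elem_group_mult elem_group_inv)

lemma rel_elem_group_UNIV: "rel_elem_group UNIV = elem_group"
  using rel_elem_group_subset elem_sub_subset_rel by (auto simp: elem_group_eq)

text \<open>Conjugating a generator \<open>f y f^-1\<close> by \<open>e\<close> gives the generator
  \<open>(e f) y (e f)^-1\<close>.\<close>

lemma rel_elem_group_normal:
  assumes e: "e \<in> elem_group" and x: "x \<in> rel_elem_group I"
  shows "e \<star> x \<star> minv e \<in> rel_elem_group I"
proof -
  let ?S = "{x \<in> carrier GL. e \<star> x \<star> minv e \<in> rel_elem_group I}"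
  have "{f \<star> y \<star> minv f |f y. f \<in> elem_group \<and> y \<in> elem_sub I} \<subseteq> ?S"
  proof clarify
    fix f y :: "'a^'b^'b" assume f: "f \<in> elem_group" and y: "y \<in> elem_sub I"
    have c: "f \<in> carrier GL" "y \<in> carrier GL" "e \<in> carrier GL"
      using f y e elem_group_carrier elem_sub_subset_elem_group by blast+
    have "(e \<star> f) \<star> y \<star> minv (e \<star> f) \<in> rel_elem_group I"
      unfolding rel_elem_group_def using f y e elem_group_mult
      by (intro generate.incl) blast
    then show "f \<star> y \<star> minv f \<in> carrier GL \<and> e \<star> (f \<star> y \<star> minv f) \<star> minv e \<in> rel_elem_group I"
      using c by (simp add: GL.inv_mult_group GL_mult_assoc)
  qed
  then have "rel_elem_group I \<subseteq> ?S"
    using GL.generate_subgroup_incl GL_conj_subgroup[OF subgroup_rel_elem_group elem_group_carrier[OF e]]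
    unfolding rel_elem_group_def by blast
  then show ?thesis using x by auto
qed

text \<open>The row is filled one position at a time: \<open>z j = 0\<close> keeps column
  \<open>j\<close> equal to that of the identity, so right multiplication by
  \<open>transvection j m (z m)\<close> changes only the entry at \<open>(j, m)\<close>.\<close>

lemma row_unipotent_elem_sub:
  assumes "0 \<in> I" and zI: "\<And>l. z l \<in> I" and zj: "z j = 0"
  shows "row_unipotent j z \<in> elem_sub I"
proof -
  have "row_unipotent j (\<lambda>l. if l \<in> S then z l else 0) \<in> elem_sub I" for S :: "'b set"
  proof (induction S rule: finite_induct[OF finite])
    case 1
    have "row_unipotent j (\<lambda>l. if l \<in> {} then z l else 0) = \<one>\<^bsub>GL\<^esub>"
      by (simp add: vec_eq_iff row_unipotent_def GL_one_nth)
    then show ?case using subgroup.one_closed[OF subgroup_elem_sub] by simp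
  next
    case (2 m S)
    show ?case
    proof (cases "m = j")
      case True
      then have "(\<lambda>l. if l \<in> insert m S then z l else 0) = (\<lambda>l. if l \<in> S then z l else 0)"
        using zj by auto
      then show ?thesis using 2 by simp
    next
      case False
      have "row_unipotent j (\<lambda>l. if l \<in> insert m S then z l else 0)
          = row_unipotent j (\<lambda>l. if l \<in> S then z l else 0) \<star> transvection j m (z m)"
        using 2 zj by (auto simp: vec_eq_iff mult_transvection_nth row_unipotent_def)
      then show ?thesis
        using 2 False zI by (simp add: subgroup.m_closed[OF subgroup_elem_sub] transvection_elem_sub)
    qed
  qed
  from this[of UNIV] show ?thesis by simp
qed

lemma col_unipotent_elem_sub:
  assumes "0 \<in> I" and cI: "\<And>l. c l \<in> I" and cj: "c j = 0"
  shows "col_unipotent j c \<in> elem_sub I"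
proof -
  have "col_unipotent j (\<lambda>l. if l \<in> S then c l else 0) \<in> elem_sub I" for S :: "'b set"
  proof (induction S rule: finite_induct[OF finite])
    case 1
    have "col_unipotent j (\<lambda>l. if l \<in> {} then c l else 0) = \<one>\<^bsub>GL\<^esub>"
      by (simp add: vec_eq_iff col_unipotent_def GL_one_nth)
    then show ?case using subgroup.one_closed[OF subgroup_elem_sub] by simp
  next
    case (2 m S)
    show ?case
    proof (cases "m = j")
      case True
      then have "(\<lambda>l. if l \<in> insert m S then c l else 0) = (\<lambda>l. if l \<in> S then c l else 0)"
        using cj by auto
      then show ?thesis using 2 by simp
    next
      case False
      have "col_unipotent j (\<lambda>l. if l \<in> insert m S then c l else 0)
          = transvection m j (c m) \<star> col_unipotent j (\<lambda>l. if l \<in> S then c l else 0)"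
        using 2 cj by (auto simp: vec_eq_iff transvection_mult_nth col_unipotent_def)
      then show ?thesis
        using 2 False cI by (simp add: subgroup.m_closed[OF subgroup_elem_sub] transvection_elem_sub)
    qed
  qed
  from this[of UNIV] show ?thesis by simp
qed

section \<open>Subgroups without transvections\<close>

definition mat_vec :: "'a::{ring,monoid_mult}^'n^'n \<Rightarrow> ('n \<Rightarrow> 'a) \<Rightarrow> 'n \<Rightarrow> 'a" where
  "mat_vec A v = (\<lambda>k. \<Sum>l\<in>UNIV. A $ k $ l * v l)"

definition unit_vec :: "'n \<Rightarrow> 'n \<Rightarrow> 'a::{ring,monoid_mult}" where
  "unit_vec j = (\<lambda>k. if k = j then 1 else 0)"

lemma mat_vec_unit_vec: "mat_vec A (unit_vec j) k = A $ k $ j"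
  by (simp add: mat_vec_def unit_vec_def delta_mult)

lemma mat_vec_one: "mat_vec \<one>\<^bsub>GL\<^esub> v = v"
  by (simp add: mat_vec_def GL_one_nth delta_mult)

lemma mat_vec_mult: "mat_vec (A \<star> B) v = mat_vec A (mat_vec B v)"
proof
  fix i
  show "mat_vec (A \<star> B) v i = mat_vec A (mat_vec B v) i"
    unfolding mat_vec_def GL_mult_nth sum_distrib_left sum_distrib_right mult.assoc
    by (rule sum.swap)
qed

lemma mat_vec_minv: "A \<in> carrier GL \<Longrightarrow> mat_vec A v = w \<Longrightarrow> mat_vec (minv A) w = v"
  by (auto simp flip: mat_vec_mult simp: mat_vec_one)

lemma mat_vec_transvection:
  "mat_vec (transvection i j r) v k = v k + (if k = i then r * v j else 0)"
  by (simp add: mat_vec_def transvection_def distrib_right sum.distrib delta_mult cong: if_cong)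

lemma mat_vec_col_unipotent: "mat_vec (col_unipotent j c) v k = v k + c k * v j"
  by (simp add: mat_vec_def col_unipotent_def distrib_right sum.distrib delta_mult)

lemma minv_col_unipotent:
  assumes "c j = 0"
  shows "minv (col_unipotent j c) = col_unipotent j (\<lambda>l. - c l)"
proof (rule GL.inv_equality)
  show "col_unipotent j (\<lambda>l. - c l) \<star> col_unipotent j c = \<one>\<^bsub>GL\<^esub>"
    using assms by (auto simp: vec_eq_iff col_unipotent_mult_nth) (auto simp: col_unipotent_def GL_one_nth)
qed (use assms in \<open>auto intro!: elem_group_carrier col_unipotent_elem_sub simp: elem_group_eq\<close>)

lemma scalar_center_GL:
  assumes x: "x \<in> carrier GL" and x_nth: "\<And>k l. x $ k $ l = (if k = l then c else 0)"
    and c: "\<And>r. c * r = r * c"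
  shows "x \<in> center_GL"
proof -
  have "(x \<star> h) $ k $ l = (h \<star> x) $ k $ l" for h k l
    using c[of "h $ k $ l"] by (simp add: GL_mult_nth x_nth delta_mult cong: if_cong)
  then show ?thesis using x by (auto simp: center_GL_def vec_eq_iff)
qed

text \<open>The assumption \<open>n \<ge> 3\<close> enters the proof through this choice of an index
  away from two given ones.\<close>

lemma third_index:
  assumes "CARD('n::finite) \<ge> 3"
  shows "\<exists>m::'n. m \<noteq> j \<and> m \<noteq> k"
proof (rule ccontr)
  assume "\<nexists>m. m \<noteq> j \<and> m \<noteq> k"
  then have "(UNIV :: 'n set) \<subseteq> {j, k}" by auto
  then have "CARD('n) \<le> card {j, k}" by (rule card_mono[rotated]) simp
  also have "\<dots> \<le> 2" by (simp add: card_insert_if)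
  finally show False using assms by simp
qed

locale transvection_free_subgroup =
  fixes N :: "('a::{ring,monoid_mult}^'n^'n) set"
  assumes card_ge_3: "CARD('n) \<ge> 3"
    and subgroup_N: "subgroup N GL"
    and conj_closed: "\<And>e x. e \<in> elem_group \<Longrightarrow> x \<in> N \<Longrightarrow> e \<star> x \<star> minv e \<in> N"
    and no_transvection: "\<And>i j r. i \<noteq> j \<Longrightarrow> transvection i j r \<in> N \<Longrightarrow> r = 0"
begin

lemmas N_carrier = subgroup.mem_carrier[OF subgroup_N]
lemmas N_mult = subgroup.m_closed[OF subgroup_N]
lemmas N_inv = subgroup.m_inv_closed[OF subgroup_N]

lemma commutator_closed:
  assumes x: "x \<in> N" and e: "e \<in> elem_group"
  shows "x \<star> e \<star> minv x \<star> minv e \<in> N"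
proof -
  have "x \<star> (e \<star> minv x \<star> minv e) \<in> N" using N_mult N_inv conj_closed x e by blast
  then show ?thesis by (simp add: GL_mult_assoc)
qed

text \<open>The way new elements of \<open>N\<close> are produced: \<open>c\<close> is recognized as
  the commutator of \<open>x\<close> and \<open>e\<close>.\<close>

lemma commutator_memI:
  assumes "x \<in> N" "e \<in> elem_group" "x \<star> e = c \<star> e \<star> x"
  shows "c \<in> N"
  using commutator_closed[OF assms(1,2)] GL_eq_commutator[OF _ _ assms(3)] assms
  by (simp add: N_carrier elem_group_carrier)

text \<open>For \<open>m\<close> different from \<open>l\<close> and \<open>j\<close>, the
  commutator with \<open>t_lm(1)\<close> isolates the entry \<open>z l\<close> in the transvection
  \<open>t_jm(z l)\<close>, which must be trivial.\<close>

lemma row_unipotent_trivial: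
  assumes x: "row_unipotent j z \<in> N" and zj: "z j = 0"
  shows "z l = 0"
proof (cases "l = j")
  case False
  obtain m where m: "m \<noteq> l" "m \<noteq> j" using third_index[OF card_ge_3] by blast
  have "transvection j m (z l) \<in> N"
  proof (rule commutator_memI[OF x transvection_elem_group])
    show "row_unipotent j z \<star> transvection l m 1
        = transvection j m (z l) \<star> transvection l m 1 \<star> row_unipotent j z"
      using m False by (auto simp: vec_eq_iff GL_mult_assoc transvection_mult_nth
          mult_transvection_nth row_unipotent_def)
  qed (use m in auto)
  then show ?thesis by (rule no_transvection[OF m(2)[symmetric]])
qed (use zj in simp)

text \<open>The commutator of \<open>x\<close> with \<open>t_jk(r)\<close> is unipotent in row
  \<open>j\<close>, hence trivial. Commuting with all \<open>t_jk(r)\<close> determines every row of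
  \<open>x\<close> except row \<open>j\<close>, and a further commutator settles that one.\<close>

lemma monomial_column_central:
  assumes x: "x \<in> N" and xj: "\<And>k. k \<noteq> j \<Longrightarrow> x $ k $ j = 0"
    and ixj: "\<And>k. k \<noteq> j \<Longrightarrow> minv x $ k $ j = 0"
  shows "x $ k $ l = (if k = l then x $ j $ j else 0)" and "x \<in> center_GL"
proof -
  let ?c = "x $ j $ j"
  let ?d = "minv x $ j $ j"
  have xc: "x \<in> carrier GL" using x N_carrier by blast
  have inv_nth: "(\<Sum>p\<in>UNIV. minv x $ k $ p * x $ p $ l) = (if k = l then 1 else 0)"
    "(\<Sum>p\<in>UNIV. x $ k $ p * minv x $ p $ l) = (if k = l then 1 else 0)" for k l
    using xc by (simp_all flip: GL_mult_nth add: GL_one_nth)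
  have "(\<Sum>p\<in>UNIV. minv x $ j $ p * x $ p $ j) = ?d * ?c"
    using xj by (subst sum.remove[of _ j]) (auto intro!: sum.neutral)
  then have dc: "?d * ?c = 1" by (simp add: inv_nth)
  have comm: "x \<star> transvection j k r = transvection j k r \<star> x" if k: "k \<noteq> j" for k r
  proof -
    \<comment> \<open>Since \<open>x e_j = e_j c\<close>, conjugating \<open>t_jk(r)\<close> by
      \<open>x\<close> gives \<open>1 + e_j c r v\<close>, where \<open>v\<close> is row
      \<open>k\<close> of the inverse; dividing by \<open>t_jk(r)\<close> subtracts \<open>r\<close>
      at position \<open>k\<close>.\<close>
    define z where "z = (\<lambda>l. ?c * r * minv x $ k $ l - (if l = k then r else 0))"
    have zj: "z j = 0" using k ixj by (auto simp: z_def)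
    have zx: "(\<Sum>m\<in>UNIV. z m * x $ m $ l) = (if l = k then ?c * r else 0) - r * x $ k $ l" for l
    proof -
      have "(\<Sum>m\<in>UNIV. z m * x $ m $ l) = ?c * r * (\<Sum>m\<in>UNIV. minv x $ k $ m * x $ m $ l) - r * x $ k $ l"
        by (simp add: z_def left_diff_distrib sum_subtractf sum_distrib_left mult.assoc delta_mult cong: if_cong)
      then show ?thesis by (simp add: inv_nth delta_mult)
    qed
    have eq: "x \<star> transvection j k r = row_unipotent j z \<star> transvection j k r \<star> x"
      using k xj zj zx
      by (simp add: vec_eq_iff GL_mult_assoc mult_transvection_nth row_unipotent_mult_nth
          transvection_mult_nth distrib_left sum.distrib delta_mult)
    then have "row_unipotent j z \<in> N"
      using k by (intro commutator_memI[OF x _ eq] transvection_elem_group) auto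
    then have "z = (\<lambda>l. 0)" using row_unipotent_trivial zj by blast
    then have "row_unipotent j z = \<one>\<^bsub>GL\<^esub>"
      by (simp add: vec_eq_iff row_unipotent_def GL_one_nth)
    then show ?thesis using eq by simp
  qed
  \<comment> \<open>Row \<open>j\<close> of the commutation relation: \<open>r = 1\<close> yields
    row \<open>k\<close> of \<open>x\<close>, and general \<open>r\<close> at \<open>l = k\<close>
    makes \<open>?c\<close> central in the ring.\<close>
  have entry: "(if l = k then ?c * r else 0) = r * x $ k $ l" if k: "k \<noteq> j" for k l r
  proof -
    have "(x \<star> transvection j k r) $ j $ l = (transvection j k r \<star> x) $ j $ l"
      using comm[OF k] by simp
    then show ?thesis by (simp add: mult_transvection_nth transvection_mult_nth)
  qed
  have off_j: "x $ k $ l = (if k = l then ?c else 0)" if k: "k \<noteq> j" for k l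
    using entry[OF k, of l 1] by (cases "l = k") simp_all
  obtain k0 where k0: "k0 \<noteq> j" using third_index[OF card_ge_3] by blast
  have c_comm: "?c * r = r * ?c" for r
  proof -
    have "?c * r = r * x $ k0 $ k0" using entry[OF k0, of k0 r] by simp
    also have "x $ k0 $ k0 = ?c" by (simp add: off_j[OF k0])
    finally show ?thesis .
  qed
  have row_j: "x $ j $ l = 0" if l: "l \<noteq> j" for l
  proof -
    obtain m where m: "m \<noteq> l" "m \<noteq> j" using third_index[OF card_ge_3] by blast
    \<comment> \<open>Column \<open>l\<close> of \<open>x\<close> has entries only at
      \<open>j\<close> and \<open>l\<close>, and row \<open>m\<close> only at \<open>m\<close>, so
      the commutator with \<open>t_lm(1)\<close> is a single transvection. The factor
      \<open>?d\<close> is cancelled by \<open>dc\<close> afterwards.\<close>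
    have "transvection j m (x $ j $ l * ?d) \<in> N"
    proof (rule commutator_memI[OF x transvection_elem_group])
      show "x \<star> transvection l m 1 = transvection j m (x $ j $ l * ?d) \<star> transvection l m 1 \<star> x"
        using m l dc by (auto simp: vec_eq_iff GL_mult_assoc mult_transvection_nth
            transvection_mult_nth off_j mult.assoc)
    qed (use m in auto)
    then have "x $ j $ l * ?d = 0" by (rule no_transvection[OF m(2)[symmetric]])
    then have "x $ j $ l * ?d * ?c = 0" by simp
    then show ?thesis by (simp only: mult.assoc dc mult_1_right)
  qed
  show scalar: "x $ k $ l = (if k = l then ?c else 0)" for k l
  proof (cases "k = j")
    case True
    then show ?thesis using row_j[of l] by auto
  next
    case False
    then show ?thesis by (rule off_j)
  qed
  show "x \<in> center_GL"
    by (rule scalar_center_GL[OF xc scalar c_comm])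
qed

text \<open>The inverse fixes the same vector, so \<open>x\<close> is scalar, and column
  \<open>j\<close> shows that the scalar is \<open>1\<close>.\<close>

lemma fixes_unit_vec_trivial:
  assumes x: "x \<in> N" and xj: "mat_vec x (unit_vec j) = unit_vec j"
  shows "x = \<one>\<^bsub>GL\<^esub>"
proof -
  have "mat_vec (minv x) (unit_vec j) = unit_vec j"
    using xj N_carrier[OF x] by (rule mat_vec_minv[rotated])
  then have cols: "minv x $ k $ j = unit_vec j k" "x $ k $ j = unit_vec j k" for k
    using xj by (simp_all flip: mat_vec_unit_vec)
  have "x $ k $ l = (if k = l then x $ j $ j else 0)" for k l
    by (rule monomial_column_central(1)[OF x]) (simp_all add: cols unit_vec_def)
  then have "x $ k $ l = (if k = l then 1 else 0)" for k l
    unfolding cols by (simp add: unit_vec_def)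
  then show ?thesis by (simp add: vec_eq_iff GL_one_nth)
qed

text \<open>As \<open>m\<close> avoids \<open>j\<close> and \<open>k\<close>, \<open>?t\<close>
  fixes both \<open>e_j\<close> and its image \<open>?y\<close>, so the commutator \<open>c\<close>
  fixes \<open>?y\<close>. Conjugation by \<open>?p\<close>, which maps \<open>?y\<close> to
  \<open>e_j\<close>, reduces to the previous lemma and gives \<open>c = 1\<close>.\<close>

lemma two_term_column_trivial:
  assumes x: "x \<in> N" and kj: "k \<noteq> j"
    and xj: "mat_vec x (unit_vec j) = (\<lambda>l. unit_vec j l + (if l = k then b else 0))"
  shows "x = \<one>\<^bsub>GL\<^esub>"
proof -
  let ?y = "\<lambda>l. unit_vec j l + (if l = k then b else 0)"
  obtain m where m: "m \<noteq> j" "m \<noteq> k" using third_index[OF card_ge_3] by blast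
  let ?t = "transvection j m (1 :: 'a)"
  let ?p = "transvection k j (- b)"
  define c where "c = x \<star> ?t \<star> minv x \<star> minv ?t"
  have xc: "x \<in> carrier GL" using x N_carrier by blast
  have t: "?t \<in> elem_group" "?p \<in> elem_group" using m kj by (auto intro: transvection_elem_group)
  have "mat_vec (minv x) ?y = unit_vec j" by (rule mat_vec_minv[OF xc xj])
  moreover have "mat_vec (minv ?p) (unit_vec j) = ?y"
    using kj by (auto simp: minv_transvection mat_vec_transvection unit_vec_def fun_eq_iff)
  moreover have "mat_vec (minv ?t) ?y = ?y"
    using m kj by (auto simp: minv_transvection mat_vec_transvection unit_vec_def fun_eq_iff)
  moreover have "mat_vec ?t (unit_vec j) = unit_vec j"
    using m kj by (auto simp: mat_vec_transvection unit_vec_def fun_eq_iff)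
  moreover have "mat_vec ?p ?y = unit_vec j"
    using m kj by (auto simp: mat_vec_transvection unit_vec_def fun_eq_iff)
  ultimately have "mat_vec (?p \<star> c \<star> minv ?p) (unit_vec j) = unit_vec j"
    by (simp only: c_def mat_vec_mult xj)
  moreover have "?p \<star> c \<star> minv ?p \<in> N"
    unfolding c_def using x t by (intro conj_closed commutator_closed)
  ultimately have "?p \<star> c \<star> minv ?p = \<one>\<^bsub>GL\<^esub>" by (rule fixes_unit_vec_trivial[rotated])
  then have "minv ?p \<star> (?p \<star> c \<star> minv ?p) \<star> ?p = \<one>\<^bsub>GL\<^esub>"
    using kj by simp
  then have "c = \<one>\<^bsub>GL\<^esub>" using kj by (simp add: GL_mult_assoc)
  then have "c \<star> ?t \<star> x = ?t \<star> x" by simp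
  then have "x \<star> ?t = ?t \<star> x" using m xc by (simp add: c_def GL_mult_assoc)
  \<comment> \<open>Here the commutation of \<open>x\<close> with \<open>?t\<close> shows that
    \<open>b\<close>, the entry of \<open>x\<close> at \<open>(k, j)\<close>, is zero.\<close>
  then have "(x \<star> ?t) $ k $ m = (?t \<star> x) $ k $ m" by simp
  then have "x $ k $ j = 0" using kj by (simp add: mult_transvection_nth transvection_mult_nth)
  then have "b = 0" using xj mat_vec_unit_vec[of x j k] kj by (simp add: unit_vec_def)
  then have "mat_vec x (unit_vec j) = unit_vec j" by (simp add: xj fun_eq_iff)
  then show ?thesis by (rule fixes_unit_vec_trivial[OF x])
qed

lemma unimodular_row_central:
  assumes g: "g \<in> N" and wj: "w j = 0" and gw: "(\<Sum>l\<in>UNIV. g $ i $ l * w l) = 1"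
  shows "g \<in> center_GL"
proof -
  have gc: "g \<in> carrier GL" using g N_carrier by blast
  obtain k where k: "k \<noteq> i" "k \<noteq> j" using third_index[OF card_ge_3] by blast
  \<comment> \<open>With this choice row \<open>i\<close> of \<open>g\<close> takes
    \<open>e_j + c\<close> to \<open>g_ij - 1 g_ij = 0\<close>, by the hypothesis on
    \<open>w\<close>.\<close>
  define c where "c = (\<lambda>l. - (w l * g $ i $ j))"
  have cj: "c j = 0" by (simp add: c_def wj)
  let ?t = "transvection k i (1 :: 'a)"
  let ?f = "col_unipotent j c"
  let ?x = "minv ?t \<star> minv g \<star> ?t \<star> g"
  let ?y = "\<lambda>l. unit_vec j l + c l"
  have t: "?t \<in> elem_group" using k by (auto intro: transvection_elem_group)
  have f: "?f \<in> elem_group"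
    using cj by (auto simp: elem_group_eq intro: col_unipotent_elem_sub)
  have fc: "?f \<in> carrier GL" using f by (rule elem_group_carrier)
  have "minv ?t \<star> minv g \<star> minv (minv ?t) \<in> N"
    by (intro conj_closed N_inv elem_group_inv g t)
  then have "minv ?t \<star> minv g \<star> ?t \<in> N" using k by simp
  then have xN: "?x \<in> N" using g by (rule N_mult)
  have gy: "mat_vec g ?y i = 0"
  proof -
    have "mat_vec g ?y i = g $ i $ j - (\<Sum>l\<in>UNIV. g $ i $ l * w l) * g $ i $ j"
      by (simp add: mat_vec_def unit_vec_def c_def distrib_left sum.distrib delta_mult
          right_diff_distrib sum_subtractf sum_distrib_right mult.assoc)
    then show ?thesis by (simp add: gw)
  qed
  have "mat_vec ?f (unit_vec j) = ?y"
    by (auto simp: mat_vec_col_unipotent unit_vec_def fun_eq_iff)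
  moreover have "mat_vec ?t (mat_vec g ?y) = mat_vec g ?y"
    using gy by (auto simp: mat_vec_transvection fun_eq_iff)
  moreover have "mat_vec (minv g) (mat_vec g ?y) = ?y"
    by (rule mat_vec_minv[OF gc refl])
  \<comment> \<open>The inverse of \<open>?t\<close> subtracts \<open>?y i\<close> at position
    \<open>k\<close> only. Entry \<open>j\<close> stays \<open>1\<close>, so the inverse of
    \<open>?f\<close> removes exactly \<open>c\<close>.\<close>
  moreover have "mat_vec (minv ?f) (mat_vec (minv ?t) ?y)
      = (\<lambda>l. unit_vec j l + (if l = k then - ?y i else 0))"
    using k cj by (auto simp: minv_transvection minv_col_unipotent mat_vec_transvection
        mat_vec_col_unipotent unit_vec_def fun_eq_iff)
  ultimately have "mat_vec (minv ?f \<star> ?x \<star> ?f) (unit_vec j)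
      = (\<lambda>l. unit_vec j l + (if l = k then - ?y i else 0))"
    by (simp only: mat_vec_mult)
  moreover have "minv ?f \<star> ?x \<star> minv (minv ?f) \<in> N"
    by (intro conj_closed elem_group_inv f xN)
  then have "minv ?f \<star> ?x \<star> ?f \<in> N" using fc by simp
  ultimately have 1: "minv ?f \<star> ?x \<star> ?f = \<one>\<^bsub>GL\<^esub>"
    by (intro two_term_column_trivial[OF _ k(2)])
  have "?x = ?f \<star> (minv ?f \<star> ?x \<star> ?f) \<star> minv ?f"
    using fc by (simp add: GL_mult_assoc)
  also have "\<dots> = \<one>\<^bsub>GL\<^esub>" unfolding 1 using fc by simp
  finally have "?x = \<one>\<^bsub>GL\<^esub>" .
  then have "g \<star> (?t \<star> ?x) = g \<star> ?t" by simp
  then have gt: "?t \<star> g = g \<star> ?t" using k gc by (simp add: GL_mult_assoc)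
  then have "minv g \<star> (?t \<star> g) \<star> minv g = minv g \<star> (g \<star> ?t) \<star> minv g" by simp
  then have igt: "?t \<star> minv g = minv g \<star> ?t" using gc by (simp add: GL_mult_assoc)
  \<comment> \<open>Commuting with \<open>t_ki(1)\<close> clears column \<open>k\<close> off the
    diagonal; this is applied to \<open>g\<close> and to its inverse, as
    \<open>monomial_column_central\<close> asks for both.\<close>
  have "x $ l $ k = 0" if "?t \<star> x = x \<star> ?t" "l \<noteq> k" for x :: "'a^'n^'n" and l
  proof -
    have "(?t \<star> x) $ l $ i = (x \<star> ?t) $ l $ i" using that by simp
    then show ?thesis using that(2) by (simp add: mult_transvection_nth transvection_mult_nth)
  qed
  from this[OF gt] this[OF igt] show ?thesis by (rule monomial_column_central(2)[OF g])
qed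

end

section \<open>Commutators with relative elementary groups\<close>

definition congruent_one :: "'a::{ring,monoid_mult} set \<Rightarrow> 'a^'n^'n \<Rightarrow> bool" where
  "congruent_one I A \<longleftrightarrow> (\<forall>k l. A $ k $ l - \<one>\<^bsub>GL\<^esub> $ k $ l \<in> I)"

lemma two_sided_idealD:
  assumes "two_sided_ideal I"
  shows "0 \<in> I" "x \<in> I \<Longrightarrow> y \<in> I \<Longrightarrow> x - y \<in> I" "x \<in> I \<Longrightarrow> r * x \<in> I" "x \<in> I \<Longrightarrow> x * r \<in> I"
    "x \<in> I \<Longrightarrow> - x \<in> I" "x \<in> I \<Longrightarrow> y \<in> I \<Longrightarrow> x + y \<in> I"
proof -
  show 0: "0 \<in> I" and diff: "x \<in> I \<Longrightarrow> y \<in> I \<Longrightarrow> x - y \<in> I" for x y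
    using assms by (auto simp: two_sided_ideal_def left_ideal_def)
  show "x \<in> I \<Longrightarrow> r * x \<in> I" "x \<in> I \<Longrightarrow> x * r \<in> I"
    using assms by (auto simp: two_sided_ideal_def left_ideal_def)
  show neg: "x \<in> I \<Longrightarrow> - x \<in> I" for x using diff[OF 0, of x] by simp
  show "x \<in> I \<Longrightarrow> y \<in> I \<Longrightarrow> x + y \<in> I" using diff[OF _ neg, of x y] by simp
qed

lemma two_sided_ideal_UNIV: "two_sided_ideal UNIV"
  by (simp add: two_sided_ideal_def left_ideal_def)

lemma two_sided_ideal_sum:
  assumes I: "two_sided_ideal I" and f: "\<And>k. k \<in> S \<Longrightarrow> f k \<in> I"
  shows "(\<Sum>k\<in>S. f k) \<in> I"
  using f by (induction S rule: infinite_finite_induct) (auto intro: two_sided_idealD[OF I])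

lemma congruence_subgroup_eq:
  assumes I: "two_sided_ideal I"
  shows "congruence_subgroup I = {g \<in> carrier GL. congruent_one I g}"
proof -
  have "(\<lambda>a. x + a) ` I = (\<lambda>a. y + a) ` I \<longleftrightarrow> x - y \<in> I" for x y :: 'a
  proof
    assume "(\<lambda>a. x + a) ` I = (\<lambda>a. y + a) ` I"
    moreover have "x + 0 \<in> (\<lambda>a. x + a) ` I" using two_sided_idealD(1)[OF I] by blast
    ultimately obtain a where "a \<in> I" "x + 0 = y + a" by blast
    then show "x - y \<in> I" by simp
  next
    have sub: "(\<lambda>a. x + a) ` I \<subseteq> (\<lambda>a. y + a) ` I" if "x - y \<in> I" for x y
    proof (rule image_subsetI)
      fix a assume "a \<in> I"
      with that have "x - y + a \<in> I" by (rule two_sided_idealD(6)[OF I])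
      then show "x + a \<in> (\<lambda>a. y + a) ` I" by (rule rev_image_eqI) simp
    qed
    assume xy: "x - y \<in> I"
    then have "y - x \<in> I" using two_sided_idealD(5)[OF I xy] by simp
    with xy show "(\<lambda>a. x + a) ` I = (\<lambda>a. y + a) ` I" by (intro equalityI sub)
  qed
  then show ?thesis by (simp add: congruence_subgroup_def congruent_one_def)
qed

lemma congruent_one_mult:
  assumes I: "two_sided_ideal I" and "congruent_one I A" "congruent_one I B"
  shows "congruent_one I (A \<star> B)"
  unfolding congruent_one_def
proof (intro allI)
  fix k l
  have "(A \<star> B) $ k $ l - \<one>\<^bsub>GL\<^esub> $ k $ l
      = (\<Sum>m\<in>UNIV. (A $ k $ m - \<one>\<^bsub>GL\<^esub> $ k $ m) * B $ m $ l) + (B $ k $ l - \<one>\<^bsub>GL\<^esub> $ k $ l)"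
    by (simp add: left_diff_distrib sum_subtractf GL_mult_nth GL_one_nth delta_mult)
  also have "\<dots> \<in> I"
    using assms by (intro two_sided_idealD(4,6)[OF I] two_sided_ideal_sum[OF I]) (auto simp: congruent_one_def)
  finally show "(A \<star> B) $ k $ l - \<one>\<^bsub>GL\<^esub> $ k $ l \<in> I" .
qed

lemma congruent_one_inv:
  assumes I: "two_sided_ideal I" and A: "congruent_one I A" "A \<in> carrier GL"
  shows "congruent_one I (minv A)"
  unfolding congruent_one_def
proof (intro allI)
  fix k l
  have "(minv A \<star> A) $ k $ l = \<one>\<^bsub>GL\<^esub> $ k $ l" using A by simp
  then have "minv A $ k $ l - \<one>\<^bsub>GL\<^esub> $ k $ l
      = - (\<Sum>m\<in>UNIV. minv A $ k $ m * (A $ m $ l - \<one>\<^bsub>GL\<^esub> $ m $ l))"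
    by (simp add: right_diff_distrib sum_subtractf GL_mult_nth GL_one_nth delta_mult)
  also have "\<dots> \<in> I"
    using A by (intro two_sided_idealD(3,5)[OF I] two_sided_ideal_sum[OF I]) (auto simp: congruent_one_def)
  finally show "minv A $ k $ l - \<one>\<^bsub>GL\<^esub> $ k $ l \<in> I" .
qed

lemma congruent_one_conj:
  assumes I: "two_sided_ideal I" and A: "congruent_one I A" and e: "e \<in> carrier GL"
  shows "congruent_one I (e \<star> A \<star> minv e)"
  unfolding congruent_one_def
proof (intro allI)
  fix k l
  have inner: "(e \<star> A) $ k $ m - e $ k $ m \<in> I" for m
  proof -
    have "(e \<star> A) $ k $ m - e $ k $ m = (\<Sum>p\<in>UNIV. e $ k $ p * (A $ p $ m - \<one>\<^bsub>GL\<^esub> $ p $ m))"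
      by (simp add: right_diff_distrib sum_subtractf GL_mult_nth GL_one_nth delta_mult)
    also have "\<dots> \<in> I"
      using A by (intro two_sided_ideal_sum[OF I] two_sided_idealD(3)[OF I]) (auto simp: congruent_one_def)
    finally show ?thesis .
  qed
  have "(e \<star> minv e) $ k $ l = \<one>\<^bsub>GL\<^esub> $ k $ l" using e by simp
  then have "(e \<star> A \<star> minv e) $ k $ l - \<one>\<^bsub>GL\<^esub> $ k $ l
      = (\<Sum>m\<in>UNIV. ((e \<star> A) $ k $ m - e $ k $ m) * minv e $ m $ l)"
    by (simp add: left_diff_distrib sum_subtractf GL_mult_nth[of "e \<star> A"] GL_mult_nth[of e "minv e"])
  also have "\<dots> \<in> I"
    using inner by (intro two_sided_ideal_sum[OF I] two_sided_idealD(4)[OF I])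
  finally show "(e \<star> A \<star> minv e) $ k $ l - \<one>\<^bsub>GL\<^esub> $ k $ l \<in> I" .
qed

lemma subgroup_congruence_subgroup:
  assumes I: "two_sided_ideal I"
  shows "subgroup (congruence_subgroup I) GL"
proof (rule GL.subgroupI)
  have "\<one>\<^bsub>GL\<^esub> \<in> congruence_subgroup I"
    by (simp add: congruence_subgroup_eq[OF I] congruent_one_def two_sided_idealD(1)[OF I])
  then show "congruence_subgroup I \<noteq> {}" by blast
qed (auto simp: congruence_subgroup_eq[OF I] congruent_one_mult[OF I] congruent_one_inv[OF I])

lemma elem_sub_subset_congruence:
  assumes I: "two_sided_ideal I"
  shows "elem_sub I \<subseteq> congruence_subgroup I"
  unfolding elem_sub_def
  by (rule GL.generate_subgroup_incl[OF _ subgroup_congruence_subgroup[OF I]])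
    (auto simp: congruence_subgroup_eq[OF I] congruent_one_def transvection_nth GL_one_nth two_sided_idealD(1)[OF I])

text \<open>Ensures that multiplying by factors from \<open>E(n, I)\<close> preserves congruence to
  \<open>1\<close> in the block decomposition.\<close>

lemma rel_elem_group_subset_congruence:
  fixes I :: "'a::{ring,monoid_mult} set"
  assumes I: "two_sided_ideal I"
  shows "rel_elem_group I \<subseteq> (congruence_subgroup I :: ('a^'n^'n) set)"
  unfolding rel_elem_group_def
proof (rule GL.generate_subgroup_incl[OF subsetI subgroup_congruence_subgroup[OF I]])
  fix y :: "'a^'n^'n" assume "y \<in> {e \<star> x \<star> minv e |e x. e \<in> elem_group \<and> x \<in> elem_sub I}"
  then obtain e x where y: "y = e \<star> x \<star> minv e" "e \<in> elem_group" "x \<in> elem_sub I" by blast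
  then have "e \<in> carrier GL" by (simp add: elem_group_carrier)
  moreover have "x \<in> carrier GL" "congruent_one I x"
    using subsetD[OF elem_sub_subset_congruence[OF I] y(3)] by (simp_all add: congruence_subgroup_eq[OF I])
  ultimately show "y \<in> congruence_subgroup I"
    using y congruent_one_conj[OF I] by (simp add: congruence_subgroup_eq[OF I])
qed

lemma congruence_subgroup_UNIV: "congruence_subgroup UNIV = carrier GL"
  by (simp add: congruence_subgroup_eq two_sided_ideal_UNIV congruent_one_def)

section \<open>Matrices with a trivial row and column\<close>

lemma transvection_commutator:
  assumes "k \<noteq> l" "k \<noteq> j" "l \<noteq> j"
  shows "transvection k l r = transvection k j r \<star> transvection j l 1
    \<star> minv (transvection k j r) \<star> minv (transvection j l 1)"
proof (rule GL_eq_commutator[symmetric])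
  show "transvection k j r \<star> transvection j l 1 = transvection k l r \<star> transvection j l 1 \<star> transvection k j r"
    using assms by (auto simp: vec_eq_iff GL_mult_assoc transvection_mult_nth mult_transvection_nth transvection_nth)
qed (use assms in auto)

text \<open>As \<open>h\<close> fixes \<open>e_j\<close> on both sides, conjugation keeps
  \<open>t_jk(r)\<close> unipotent in row \<open>j\<close> and \<open>t_kj(r)\<close> unipotent in
  column \<open>j\<close>. The commutator entries are \<open>r\<close> times entries of
  \<open>h^-1 - 1\<close>, respectively entries of \<open>h - 1\<close> times \<open>r\<close>, and
  so lie in both ideals.\<close>

lemma block_commutator_transvection:
  assumes I: "two_sided_ideal I" and J: "two_sided_ideal J" and h: "h \<in> congruence_subgroup I"
    and hj: "\<And>k. h $ k $ j = (if k = j then 1 else 0)" "\<And>k. h $ j $ k = (if k = j then 1 else 0)"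
    and k: "k \<noteq> j" and r: "r \<in> J"
  shows "h \<star> transvection j k r \<star> minv h \<star> minv (transvection j k r) \<in> elem_sub (I \<inter> J)"
    and "h \<star> transvection k j r \<star> minv h \<star> minv (transvection k j r) \<in> elem_sub (I \<inter> J)"
proof -
  have hc: "h \<in> carrier GL" and hI: "congruent_one I h"
    using h by (auto simp: congruence_subgroup_eq[OF I])
  have iI: "congruent_one I (minv h)" using congruent_one_inv[OF I hI hc] .
  have inv_nth: "(\<Sum>p\<in>UNIV. minv h $ k $ p * h $ p $ l) = (if k = l then 1 else 0)"
    "(\<Sum>p\<in>UNIV. h $ k $ p * minv h $ p $ l) = (if k = l then 1 else 0)" for k l
    using hc by (simp_all flip: GL_mult_nth add: GL_one_nth)
  have ij: "minv h $ l $ j = (if l = j then 1 else 0)" for l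
    using inv_nth(1)[of l j] by (simp add: hj delta_mult)
  define z where "z = (\<lambda>l. r * (minv h $ k $ l - \<one>\<^bsub>GL\<^esub> $ k $ l))"
  have z: "z j = 0" "z l \<in> I \<inter> J" for l
    using k ij iI two_sided_idealD(3)[OF I] two_sided_idealD(4)[OF J r]
    by (simp_all add: z_def GL_one_nth[of k j] congruent_one_def)
  have "(\<Sum>m\<in>UNIV. z m * h $ m $ l) = (if l = k then r else 0) - r * h $ k $ l" for l
  proof -
    have "(\<Sum>m\<in>UNIV. z m * h $ m $ l) = r * (\<Sum>m\<in>UNIV. minv h $ k $ m * h $ m $ l) - r * h $ k $ l"
      by (simp add: z_def GL_one_nth left_diff_distrib right_diff_distrib sum_subtractf sum_distrib_left mult.assoc delta_mult cong: if_cong)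
    then show ?thesis by (simp add: inv_nth delta_mult)
  qed
  then have "h \<star> transvection j k r = row_unipotent j z \<star> transvection j k r \<star> h"
    using k hj z(1)
    by (simp add: vec_eq_iff GL_mult_assoc mult_transvection_nth row_unipotent_mult_nth
          transvection_mult_nth distrib_left sum.distrib delta_mult)
  then have "h \<star> transvection j k r \<star> minv h \<star> minv (transvection j k r) = row_unipotent j z"
    using k hc by (intro GL_eq_commutator) auto
  then show "h \<star> transvection j k r \<star> minv h \<star> minv (transvection j k r) \<in> elem_sub (I \<inter> J)"
    using z two_sided_idealD(1)[OF I] two_sided_idealD(1)[OF J]
    by (auto intro: row_unipotent_elem_sub)
  define c where "c = (\<lambda>l. (h $ l $ k - \<one>\<^bsub>GL\<^esub> $ l $ k) * r)"
  have c: "c j = 0" "c l \<in> I \<inter> J" for l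
    using k hj hI two_sided_idealD(4)[OF I] two_sided_idealD(3)[OF J r]
    by (simp_all add: c_def GL_one_nth[of j k] congruent_one_def)
  have "h \<star> transvection k j r = col_unipotent j c \<star> transvection k j r \<star> h"
    using k hj c(1)
    by (auto simp: vec_eq_iff GL_mult_assoc mult_transvection_nth col_unipotent_mult_nth
          transvection_mult_nth c_def GL_one_nth algebra_simps)
  then have "h \<star> transvection k j r \<star> minv h \<star> minv (transvection k j r) = col_unipotent j c"
    using k hc by (intro GL_eq_commutator) auto
  then show "h \<star> transvection k j r \<star> minv h \<star> minv (transvection k j r) \<in> elem_sub (I \<inter> J)"
    using c two_sided_idealD(1)[OF I] two_sided_idealD(1)[OF J]
    by (auto intro: col_unipotent_elem_sub)
qed

text \<open>By normality of \<open>E(n, I)\<close> the admissible \<open>x\<close> form a subgroup.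
  It contains the transvections involving \<open>j\<close> by the explicit formulas, and the others
  as commutators of these.\<close>

lemma block_commutator_elem_group:
  assumes I: "two_sided_ideal I" and h: "h \<in> congruence_subgroup I"
    and hj: "\<And>k. h $ k $ j = (if k = j then 1 else 0)" "\<And>k. h $ j $ k = (if k = j then 1 else 0)"
    and x: "x \<in> elem_group"
  shows "h \<star> x \<star> minv h \<star> minv x \<in> rel_elem_group I"
proof -
  let ?S = "{x \<in> elem_group. h \<star> x \<star> minv h \<star> minv x \<in> rel_elem_group I}"
  have hc: "h \<in> carrier GL" using h by (simp add: congruence_subgroup_def)
  have S: "subgroup ?S GL"
    by (rule GL_commutator_subgroup[OF subgroup_elem_group subgroup_rel_elem_group hc rel_elem_group_normal])
  have IR: "elem_sub (I \<inter> UNIV) \<subseteq> rel_elem_group I" using elem_sub_subset_rel by simp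
  have 1: "transvection j k r \<in> ?S" "transvection k j r \<in> ?S" if "k \<noteq> j" for k r
    using block_commutator_transvection[OF I two_sided_ideal_UNIV h hj that, of r] subsetD[OF IR] that
    by (simp_all add: transvection_elem_group)
  have "transvection k l r \<in> ?S" if kl: "k \<noteq> l" for k l r
  proof (cases "k = j \<or> l = j")
    case True
    then show ?thesis using 1(1)[of l r] 1(2)[of k r] kl by (cases "k = j") auto
  next
    case False
    then have "transvection k l r = transvection k j r \<star> transvection j l 1
        \<star> minv (transvection k j r) \<star> minv (transvection j l 1)"
      using kl by (intro transvection_commutator) auto
    also have "\<dots> \<in> ?S"
      using False by (intro subgroup.m_closed[OF S] subgroup.m_inv_closed[OF S] 1) auto
    finally show ?thesis .
  qed
  then have "elem_group \<subseteq> ?S"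
    by (subst elem_group_def, intro GL.generate_subgroup_incl[OF _ S]) auto
  then show ?thesis using x by blast
qed


text \<open>For fixed \<open>e\<close> the \<open>x\<close> with \<open>e x e^-1\<close> in
  \<open>S\<close> form a subgroup, so conjugates of single transvections suffice.\<close>

lemma rel_elem_groupI:
  assumes S: "subgroup S GL"
    and conj: "\<And>e i j r. e \<in> elem_group \<Longrightarrow> i \<noteq> j \<Longrightarrow> r \<in> J \<Longrightarrow> e \<star> transvection i j r \<star> minv e \<in> S"
  shows "rel_elem_group J \<subseteq> S"
  unfolding rel_elem_group_def
proof (rule GL.generate_subgroup_incl[OF subsetI S])
  fix y :: "'a^'b^'b" assume "y \<in> {e \<star> x \<star> minv e |e x. e \<in> elem_group \<and> x \<in> elem_sub J}"
  then obtain e x where y: "y = e \<star> x \<star> minv e" "e \<in> elem_group" "x \<in> elem_sub J" by blast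
  have "elem_sub J \<subseteq> {x \<in> carrier GL. e \<star> x \<star> minv e \<in> S}"
    unfolding elem_sub_def
    by (rule GL.generate_subgroup_incl[OF _ GL_conj_subgroup[OF S elem_group_carrier[OF y(2)]]])
      (use conj[OF y(2)] in auto)
  then show "y \<in> S" using y by blast
qed

lemma block_normalizes_rel_elem_group:
  assumes J: "two_sided_ideal J" and h: "h \<in> carrier GL"
    and hj: "\<And>k. h $ k $ j = (if k = j then 1 else 0)" "\<And>k. h $ j $ k = (if k = j then 1 else 0)"
    and x: "x \<in> rel_elem_group J"
  shows "h \<star> x \<star> minv h \<in> rel_elem_group J"
proof -
  let ?S = "{x \<in> carrier GL. h \<star> x \<star> minv h \<in> rel_elem_group J}"
  have S: "subgroup ?S GL" by (rule GL_conj_subgroup[OF subgroup_rel_elem_group h])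
  have hU: "h \<in> congruence_subgroup UNIV" using h by (simp add: congruence_subgroup_UNIV)
  have hE: "h \<star> e \<star> minv h \<in> elem_group" if e: "e \<in> elem_group" for e
  proof -
    have "h \<star> e \<star> minv h \<star> minv e \<in> elem_group"
      using block_commutator_elem_group[OF two_sided_ideal_UNIV hU hj e] by (simp add: rel_elem_group_UNIV)
    then have "h \<star> e \<star> minv h \<star> minv e \<star> e \<in> elem_group" using e by (rule elem_group_mult)
    then show ?thesis using e by (simp add: GL_mult_assoc elem_group_carrier)
  qed
  have 1: "transvection j k r \<in> ?S" "transvection k j r \<in> ?S" if k: "k \<noteq> j" and r: "r \<in> J" for k r
  proof -
    have "h \<star> t \<star> minv h \<in> rel_elem_group J"
      if "h \<star> t \<star> minv h \<star> minv t \<in> elem_sub (UNIV \<inter> J)" and t: "t \<in> elem_sub J" for t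
    proof -
      have "h \<star> t \<star> minv h \<star> minv t \<star> t \<in> elem_sub J"
        by (rule subgroup.m_closed[OF subgroup_elem_sub]) (use that in simp_all)
      then show ?thesis
        using subsetD[OF elem_sub_subset_rel] subgroup.mem_carrier[OF subgroup_elem_sub t]
        by (simp add: GL_mult_assoc)
    qed
    from this[OF block_commutator_transvection(1)[OF two_sided_ideal_UNIV J hU hj k r]]
      this[OF block_commutator_transvection(2)[OF two_sided_ideal_UNIV J hU hj k r]]
    show "transvection j k r \<in> ?S" "transvection k j r \<in> ?S"
      using k r by (simp_all add: transvection_elem_sub)
  qed
  have 2: "transvection k l r \<in> ?S" if kl: "k \<noteq> l" and r: "r \<in> J" for k l r
  proof (cases "k = j \<or> l = j")
    case True
    then show ?thesis using 1(1)[of l r] 1(2)[of k r] kl r by (cases "k = j") auto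
  next
    case False
    \<comment> \<open>Only \<open>?a\<close> has its parameter in \<open>J\<close>; the conjugate
      \<open>?b'\<close> is merely in \<open>E(n, R)\<close>. That suffices, since
      \<open>[?a', ?b']\<close> is \<open>?a'\<close> times an \<open>E(n, R)\<close>-conjugate of
      its inverse.\<close>
    let ?a = "transvection k j r" and ?b = "transvection j l 1"
    let ?a' = "h \<star> ?a \<star> minv h" and ?b' = "h \<star> ?b \<star> minv h"
    have a: "?a' \<in> rel_elem_group J" using 1(2)[of k r] False r by simp
    have b: "?b' \<in> elem_group" using False by (intro hE transvection_elem_group) auto
    have "?a' \<star> (?b' \<star> minv ?a' \<star> minv ?b') \<in> rel_elem_group J"
      by (intro subgroup.m_closed[OF subgroup_rel_elem_group] a
          rel_elem_group_normal b subgroup.m_inv_closed[OF subgroup_rel_elem_group])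
    also have "?a' \<star> (?b' \<star> minv ?a' \<star> minv ?b') = h \<star> (?a \<star> ?b \<star> minv ?a \<star> minv ?b) \<star> minv h"
      using False h by (auto simp: GL.inv_mult_group GL_mult_assoc)
    also have "?a \<star> ?b \<star> minv ?a \<star> minv ?b = transvection k l r"
      using False kl by (intro transvection_commutator[symmetric]) auto
    finally show ?thesis using kl by simp
  qed
  have "rel_elem_group J \<subseteq> ?S"
  proof (rule rel_elem_groupI[OF S])
    fix e :: "'a^'b^'b" and k l :: 'b and r
    assume e: "e \<in> elem_group" and kl: "k \<noteq> l" and r: "r \<in> J"
    let ?e' = "h \<star> e \<star> minv h"
    have "?e' \<star> (h \<star> transvection k l r \<star> minv h) \<star> minv ?e' \<in> rel_elem_group J"
      by (rule rel_elem_group_normal[OF hE[OF e]]) (use 2[OF kl r] in simp)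
    then show "e \<star> transvection k l r \<star> minv e \<in> ?S"
      using kl h elem_group_carrier[OF e] by (simp add: GL.inv_mult_group GL_mult_assoc)
  qed
  then show ?thesis using x by blast
qed

section \<open>Reduction to a trivial row and column\<close>

lemma block_decomposition:
  fixes g :: "'a::{ring,monoid_mult}^'n^'n"
  assumes I: "two_sided_ideal I" and g: "g \<in> congruence_subgroup I"
    and gij: "g $ i $ j \<in> jacobson_radical"
  shows "\<exists>\<epsilon>\<in>rel_elem_group I. \<exists>\<delta>\<in>rel_elem_group I. \<exists>h\<in>congruence_subgroup I.
    (\<forall>k. h $ k $ j = (if k = j then 1 else 0)) \<and> (\<forall>k. h $ j $ k = (if k = j then 1 else 0)) \<and>
    g = \<epsilon> \<star> h \<star> \<delta>"
proof -
  have gc: "g \<in> carrier GL" and gI: "congruent_one I g"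
    using g by (auto simp: congruence_subgroup_eq[OF I])
  note relE = subsetD[OF elem_sub_subset_rel] and ideal = two_sided_idealD[OF I]
  have rel_car: "x \<in> carrier GL" if "x \<in> rel_elem_group I" for x :: "'a^'n^'n"
    by (rule subgroup.mem_carrier[OF subgroup_rel_elem_group that])
  have rel_cong: "x \<in> congruence_subgroup I" if "x \<in> rel_elem_group I" for x :: "'a^'n^'n"
    by (rule subsetD[OF rel_elem_group_subset_congruence[OF I] that])
  define u where "u = (\<lambda>k. g $ k $ j)"
  have u: "u k - unit_vec j k \<in> I" for k
    using gI by (simp add: congruent_one_def u_def unit_vec_def GL_one_nth)
  have gu: "mat_vec g (unit_vec j) = u" by (simp add: fun_eq_iff mat_vec_unit_vec u_def)
  have "(\<Sum>l\<in>UNIV. minv g $ j $ l * u l) = 1"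
    using gc by (simp add: u_def GL_one_nth flip: GL_mult_nth)
  then obtain w where wi: "w i = 0" and wu: "(\<Sum>l\<in>UNIV. w l * u l) = 1"
    using column_unimodular_jacobson[of u i] gij unfolding u_def by blast
  \<comment> \<open>The new value for entry \<open>i\<close> of the column \<open>u\<close>: it is
    \<open>1\<close> on the diagonal, and otherwise the value for which adding entry
    \<open>i\<close> to entry \<open>j\<close> produces \<open>1\<close>.\<close>
  define target where "target = (if i = j then 1 else 1 - u j)"
  have target: "target - u i \<in> I"
  proof (cases "i = j")
    case True
    then show ?thesis using ideal(5)[OF u[of i]] by (simp add: target_def unit_vec_def)
  next
    case False
    then show ?thesis using ideal(5)[OF ideal(6)[OF u[of i] u[of j]]]
      by (simp add: target_def unit_vec_def algebra_simps)
  qed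
  \<comment> \<open>Because \<open>w\<close> is a left inverse of \<open>u\<close>, this row
    operation adds exactly \<open>target - u i\<close> at position \<open>i\<close>;
    \<open>wi\<close> and \<open>target\<close> place it in \<open>E(n, I)\<close>.\<close>
  define e1 where "e1 = row_unipotent i (\<lambda>l. (target - u i) * w l)"
  have e1: "e1 \<in> rel_elem_group I"
    unfolding e1_def using ideal(4)[OF target] wi ideal(1)
    by (intro relE row_unipotent_elem_sub) auto
  define u1 where "u1 = (\<lambda>k. if k = i then target else u k)"
  have e1u: "mat_vec e1 u = u1"
  proof
    fix k
    have "mat_vec e1 u k = u k + (if k = i then (target - u i) * (\<Sum>l\<in>UNIV. w l * u l) else 0)"
      by (simp add: e1_def mat_vec_def row_unipotent_def distrib_right sum.distrib delta_mult
          sum_distrib_left mult.assoc)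
    then show "mat_vec e1 u k = u1 k" by (simp add: wu u1_def)
  qed
  define t :: "'a^'n^'n" where "t = (if i = j then \<one>\<^bsub>GL\<^esub> else transvection j i 1)"
  have t: "t \<in> elem_group" "t \<in> carrier GL"
    by (auto simp: t_def transvection_elem_group subgroup.one_closed[OF subgroup_elem_group])
  have tj: "mat_vec t (unit_vec j) = unit_vec j"
    by (auto simp: t_def mat_vec_one mat_vec_transvection unit_vec_def fun_eq_iff)
  define u2 where "u2 = (\<lambda>k. if k = j then 1 else u1 k)"
  have tu: "mat_vec t u1 = u2"
    by (auto simp: t_def mat_vec_one mat_vec_transvection u1_def u2_def target_def fun_eq_iff)
  \<comment> \<open>With \<open>1\<close> now at position \<open>j\<close>, the rest of the column
    is cleared. For \<open>i \<noteq> j\<close> the entry at \<open>i\<close> is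
    \<open>1 - u j\<close>, which lies in \<open>I\<close> by congruence.\<close>
  define c where "c = (\<lambda>k. if k = j then 0 else - u2 k)"
  have cI: "c k \<in> I" for k
  proof -
    have "c k = 0 \<or> k \<noteq> j \<and> k \<noteq> i \<and> c k = - (u k - unit_vec j k)
        \<or> i \<noteq> j \<and> c k = u j - unit_vec j j"
      by (auto simp: c_def u2_def u1_def target_def unit_vec_def)
    then show ?thesis using ideal(1) ideal(5)[OF u[of k]] u[of j] by metis
  qed
  define e2 where "e2 = col_unipotent j c"
  have e2: "e2 \<in> rel_elem_group I"
    unfolding e2_def using cI ideal(1) by (intro relE col_unipotent_elem_sub) (auto simp: c_def)
  have e2u: "mat_vec e2 u2 = unit_vec j"
    by (auto simp: e2_def mat_vec_col_unipotent c_def u2_def unit_vec_def fun_eq_iff)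
  \<comment> \<open>The auxiliary \<open>t\<close> is only known to lie in \<open>E(n, R)\<close>.
    Undoing it at the end, which is harmless as it fixes \<open>e_j\<close>, turns \<open>e2\<close>
    into a conjugate and keeps the product in \<open>E(n, I)\<close>.\<close>
  define \<epsilon> where "\<epsilon> = minv t \<star> e2 \<star> minv (minv t) \<star> e1"
  have \<epsilon>: "\<epsilon> \<in> rel_elem_group I"
    unfolding \<epsilon>_def using t e1 e2
    by (intro subgroup.m_closed[OF subgroup_rel_elem_group] rel_elem_group_normal elem_group_inv)
  define h1 where "h1 = \<epsilon> \<star> g"
  have "mat_vec h1 (unit_vec j) = unit_vec j"
    using t(2) by (simp add: h1_def \<epsilon>_def mat_vec_mult gu e1u tu e2u mat_vec_minv[OF t(2) tj])
  then have h1j: "h1 $ k $ j = (if k = j then 1 else 0)" for k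
    using mat_vec_unit_vec[of h1 j k] by (simp add: unit_vec_def)
  have h1c: "h1 \<in> congruence_subgroup I"
    unfolding h1_def by (intro subgroup.m_closed[OF subgroup_congruence_subgroup[OF I]] rel_cong \<epsilon> g)
  then have h1I: "congruent_one I h1" by (simp add: congruence_subgroup_eq[OF I])
  \<comment> \<open>Column \<open>j\<close> is already \<open>e_j\<close>, so right multiplication
    by \<open>row_unipotent j z\<close> alters row \<open>j\<close> alone.\<close>
  define z where "z = (\<lambda>l. if l = j then 0 else - (h1 $ j $ l))"
  have zI: "z l \<in> I" for l
  proof (cases "l = j")
    case False
    have "h1 $ j $ l - \<one>\<^bsub>GL\<^esub> $ j $ l \<in> I" using h1I unfolding congruent_one_def by blast
    from ideal(5)[OF this] show ?thesis using False by (simp add: z_def GL_one_nth)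
  qed (simp add: z_def ideal(1))
  define d where "d = row_unipotent j z"
  have d: "d \<in> rel_elem_group I"
    unfolding d_def using zI ideal(1) by (intro relE row_unipotent_elem_sub) (auto simp: z_def)
  define h where "h = h1 \<star> d"
  have h: "h \<in> congruence_subgroup I"
    unfolding h_def by (intro subgroup.m_closed[OF subgroup_congruence_subgroup[OF I]] rel_cong d h1c)
  have hj: "h $ k $ j = (if k = j then 1 else 0)" "h $ j $ k = (if k = j then 1 else 0)" for k
    using h1j by (simp_all add: h_def d_def mult_row_unipotent_nth z_def)
  have "g = minv \<epsilon> \<star> h \<star> minv d"
    using rel_car[OF \<epsilon>] rel_car[OF d] by (simp add: h_def h1_def GL_mult_assoc)
  moreover have "minv \<epsilon> \<in> rel_elem_group I" "minv d \<in> rel_elem_group I"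
    using \<epsilon> d by (auto intro: subgroup.m_inv_closed[OF subgroup_rel_elem_group])
  ultimately show ?thesis using h hj by blast
qed

section \<open>Commutators and conjugation by matrices with an entry in the radical\<close>

lemma commutator_rel_elem_group_mult:
  assumes g: "g \<in> carrier GL" "\<And>x. x \<in> elem_group \<Longrightarrow> g \<star> x \<star> minv g \<star> minv x \<in> rel_elem_group I"
    and h: "h \<in> carrier GL" "\<And>x. x \<in> elem_group \<Longrightarrow> h \<star> x \<star> minv h \<star> minv x \<in> rel_elem_group I"
    and x: "x \<in> elem_group"
  shows "(g \<star> h) \<star> x \<star> minv (g \<star> h) \<star> minv x \<in> rel_elem_group I"
proof -
  obtain y where y_def: "y = h \<star> x \<star> minv h \<star> minv x" by blast
  note mult = subgroup.m_closed[OF subgroup_rel_elem_group]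
  have y: "y \<in> rel_elem_group I" unfolding y_def using h(2) x .
  have yE: "y \<in> elem_group" by (rule subsetD[OF rel_elem_group_subset y])
  \<comment> \<open>Uses \<open>[gh, x] = g y g^-1 [g, x]\<close> with \<open>y = [h, x]\<close>,
    where \<open>g y g^-1 = [g, y] y\<close>.\<close>
  have "(g \<star> y \<star> minv g \<star> minv y) \<star> y \<star> (g \<star> x \<star> minv g \<star> minv x) \<in> rel_elem_group I"
    by (intro mult g(2) y yE x)
  then have "g \<star> y \<star> minv g \<star> (g \<star> x \<star> minv g \<star> minv x) \<in> rel_elem_group I"
    using elem_group_carrier[OF yE] by (simp add: GL_mult_assoc)
  then show ?thesis
    unfolding y_def using g(1) h(1) elem_group_carrier[OF x] by (simp add: GL.inv_mult_group GL_mult_assoc)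
qed

lemma rel_elem_group_commutator:
  assumes e: "e \<in> rel_elem_group I" and x: "x \<in> elem_group"
  shows "e \<star> x \<star> minv e \<star> minv x \<in> rel_elem_group I"
proof -
  have "e \<star> (x \<star> minv e \<star> minv x) \<in> rel_elem_group I"
    using e x by (intro subgroup.m_closed[OF subgroup_rel_elem_group] rel_elem_group_normal
        subgroup.m_inv_closed[OF subgroup_rel_elem_group])
  then show ?thesis by (simp add: GL_mult_assoc)
qed

text \<open>In the decomposition of \<open>g\<close> modulo \<open>I\<close>, the outer factors are
  handled by normality of \<open>E(n, I)\<close> and the middle one by its block form.\<close>

lemma commutator_elem_group:
  assumes I: "two_sided_ideal I" and g: "g \<in> congruence_subgroup I"
    and gij: "g $ i $ j \<in> jacobson_radical" and x: "x \<in> elem_group"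
  shows "g \<star> x \<star> minv g \<star> minv x \<in> rel_elem_group I"
proof -
  obtain \<epsilon> h \<delta> where \<epsilon>: "\<epsilon> \<in> rel_elem_group I" and \<delta>: "\<delta> \<in> rel_elem_group I"
    and h: "h \<in> congruence_subgroup I"
    and hj: "\<And>k. h $ k $ j = (if k = j then 1 else 0)" "\<And>k. h $ j $ k = (if k = j then 1 else 0)"
    and eq: "g = \<epsilon> \<star> h \<star> \<delta>"
    using block_decomposition[OF I g gij] by blast
  have car: "\<epsilon> \<in> carrier GL" "\<delta> \<in> carrier GL" "h \<in> carrier GL"
    using subgroup.mem_carrier[OF subgroup_rel_elem_group] \<epsilon> \<delta> h by (auto simp: congruence_subgroup_def)
  note [intro] = rel_elem_group_commutator block_commutator_elem_group[OF I h hj]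
  have "(\<epsilon> \<star> h) \<star> y \<star> minv (\<epsilon> \<star> h) \<star> minv y \<in> rel_elem_group I" if "y \<in> elem_group" for y
    by (rule commutator_rel_elem_group_mult[OF car(1) _ car(3) _ that]) (use \<epsilon> in auto)
  then show ?thesis
    unfolding eq
    by (rule commutator_rel_elem_group_mult[OF GL.m_closed[OF car(1,3)] _ car(2) _ x]) (use \<delta> in auto)
qed

text \<open>The decomposition is taken for the unit ideal: its outer factors then lie in
  \<open>E(n, R)\<close>, which normalizes \<open>E(n, J)\<close>, and so does the block
  factor.\<close>

lemma normalizes_rel_elem_group:
  assumes J: "two_sided_ideal J" and g: "g \<in> carrier GL"
    and gij: "g $ i $ j \<in> jacobson_radical" and x: "x \<in> rel_elem_group J"
  shows "g \<star> x \<star> minv g \<in> rel_elem_group J"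
proof -
  obtain \<epsilon> h \<delta> where \<epsilon>: "\<epsilon> \<in> elem_group" and \<delta>: "\<delta> \<in> elem_group"
    and h: "h \<in> carrier GL"
    and hj: "\<And>k. h $ k $ j = (if k = j then 1 else 0)" "\<And>k. h $ j $ k = (if k = j then 1 else 0)"
    and eq: "g = \<epsilon> \<star> h \<star> \<delta>"
    using block_decomposition[OF two_sided_ideal_UNIV, of g i j] g gij
    unfolding congruence_subgroup_UNIV rel_elem_group_UNIV by blast
  have "\<epsilon> \<star> (h \<star> (\<delta> \<star> x \<star> minv \<delta>) \<star> minv h) \<star> minv \<epsilon> \<in> rel_elem_group J"
    by (intro rel_elem_group_normal block_normalizes_rel_elem_group[OF J h hj] \<epsilon> \<delta> x)
  then show ?thesis
    unfolding eq using elem_group_carrier[OF \<epsilon>] elem_group_carrier[OF \<delta>] h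
    by (simp add: GL.inv_mult_group GL_mult_assoc)
qed

theorem theorem2:
  fixes g :: "'a::{ring,monoid_mult}^'n^'n"
  assumes "CARD('n) \<ge> 3"
    and "g \<in> carrier GL"
    and "\<exists>i j. g $ i $ j \<in> jacobson_radical"
  shows "stable_element g"
proof -
  obtain i j where gij: "g $ i $ j \<in> jacobson_radical" using assms(3) by blast
  have "commutator_subgroup g (rel_elem_group J) \<subseteq> rel_elem_group I \<inter> rel_elem_group J"
    if I: "two_sided_ideal I" and J: "two_sided_ideal J" and gI: "g \<in> congruence_subgroup I" for I J
    unfolding commutator_subgroup_def
  proof (rule GL.generate_subgroup_incl[OF _ GL.subgroups_Inter_pair[OF subgroup_rel_elem_group subgroup_rel_elem_group]], clarify)
    fix x :: "'a^'n^'n" assume x: "x \<in> rel_elem_group J"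
    have "g \<star> x \<star> minv g \<star> minv x \<in> rel_elem_group I"
      by (rule commutator_elem_group[OF I gI gij subsetD[OF rel_elem_group_subset x]])
    moreover have "g \<star> x \<star> minv g \<star> minv x \<in> rel_elem_group J"
      by (intro subgroup.m_closed[OF subgroup_rel_elem_group] subgroup.m_inv_closed[OF subgroup_rel_elem_group]
          normalizes_rel_elem_group[OF J assms(2) gij] x)
    ultimately show "g \<star> x \<star> minv g \<star> minv x \<in> rel_elem_group I \<inter> rel_elem_group J" by blast
  qed
  moreover have "g \<in> center_GL"
    if N: "subgroup N GL" "normalized_by_elem_group N" "g \<in> N"
      and triv: "\<forall>i j r. i \<noteq> j \<and> transvection i j r \<in> N \<longrightarrow> transvection i j r = \<one>\<^bsub>GL\<^esub>" for N
  proof -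
    interpret transvection_free_subgroup N
    proof (rule transvection_free_subgroup.intro)
      show "e \<star> x \<star> minv e \<in> N" if "e \<in> elem_group" "x \<in> N" for e x
        using N(2) that unfolding normalized_by_elem_group_def by blast
      show "r = 0" if "i \<noteq> j" "transvection i j r \<in> N" for i j and r :: 'a
        using triv that transvection_eq_one_iff by blast
    qed (use assms(1) N(1) in auto)
    \<comment> \<open>Column \<open>i\<close> of the inverse shows that row \<open>i\<close> of
      \<open>g\<close> is right unimodular; the radical entry then allows a solution vanishing at
      \<open>j\<close>.\<close>
    have "(\<Sum>l\<in>UNIV. g $ i $ l * minv g $ l $ i) = 1"
      using assms(2) by (simp add: GL_one_nth flip: GL_mult_nth)
    then obtain w where "w j = 0" "(\<Sum>l\<in>UNIV. g $ i $ l * w l) = 1"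
      using row_unimodular_jacobson[of "\<lambda>l. g $ i $ l" j "\<lambda>l. minv g $ l $ i"] gij by blast
    then show ?thesis by (rule unimodular_row_central[OF N(3)])
  qed
  ultimately show ?thesis
    using assms(2) unfolding stable_element_def by blast
qed

end
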